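(* Let $H$ be a connected plane graph of diameter $d$, and let $\alpha \geq d$ be an integer. Suppose there exists a plane graph $G$ containing $H$ as a plane subgraph (the embedding of $G$ restricts to the given embedding of $H$) such that $H$ is an isometric subgraph of $G$ and $V(H)\subseteq \mathcal{E}_G(\alpha)$. Then for every vertex $u$ of $H$ with $e_H(u)<\alpha$, there exists a face $f$ of $H$ such that $u\in \mathrm{qcc}_H(H[f])$.
   Context: All graphs are finite and simple. For a graph $G$ and vertices $u,v$, $d_G(u,v)$ is the length of a shortest $u$–$v$ path; for sets $A,B$ of vertices, $d_G(A,B)=\min\{d_G(a,b): a\in A, b\in B\}$. The eccentricity of $u$ is $e_G(u)=\max\{d_G(u,x): x\in V(G)\}$. The $i$-th eccentricity layer is $\mathcal{E}_G(i)=\{v\in V(G): e_G(v)=i\}$. A subgraph $H$ of $G$ is isometric if $d_H(u,v)=d_G(u,v)$ for all $u,v\in V(H)$. For a plane graph $H$ and a face $f$ of $H$, $H[f]$ denotes the subgraph consisting of all vertices and edges of $H$ lying on the boundary of $f$. For a graph $H$ and a set $S\subseteq V(H)$ (or a subgraph, meaning its vertex set), the set of quasi-eccentric vertices of $S$ is $\mathrm{qcc}_H(S)=\{u\in V(H): \text{for every } v\in V(H) \text{ there is } s\in S \text{ with } d_H(u,s)\geq d_H(v,s)\}$. *)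

theory Defs
  imports "HOL-Analysis.Analysis" "Graph_Theory.Pair_Digraph" "Graph_Theory.Digraph_Component"
begin

subsection \<open>Distances in graphs\<close>

text \<open>
  A finite simple graph is a symmetric loopless digraph, as in the locale \<^locale>\<open>pair_graph\<close>.
  The definitions below are made for arbitrary digraphs. The distance is \<open>\<infinity>\<close> if there is no path.
\<close>

definition gdist :: "('a, 'b) pre_digraph \<Rightarrow> 'a \<Rightarrow> 'a \<Rightarrow> enat" where
  "gdist G u v = (INF p \<in> {p. pre_digraph.apath G u p v}. enat (length p))"

definition ecc :: "('a, 'b) pre_digraph \<Rightarrow> 'a \<Rightarrow> enat" where
  "ecc G u = Max {gdist G u x | x. x \<in> verts G}"

definition ecc_layer :: "('a, 'b) pre_digraph \<Rightarrow> nat \<Rightarrow> 'a set" where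
  "ecc_layer G i = {v \<in> verts G. ecc G v = enat i}"

definition gdiam :: "('a, 'b) pre_digraph \<Rightarrow> enat" where
  "gdiam G = Max {gdist G u v | u v. u \<in> verts G \<and> v \<in> verts G}"

definition isometric_subgraph :: "('a, 'b) pre_digraph \<Rightarrow> ('a, 'b) pre_digraph \<Rightarrow> bool" where
  "isometric_subgraph H G \<longleftrightarrow>
    subgraph H G \<and> (\<forall>u\<in>verts H. \<forall>v\<in>verts H. gdist H u v = gdist G u v)"

definition qcc :: "('a, 'b) pre_digraph \<Rightarrow> 'a set \<Rightarrow> 'a set" where
  "qcc H S = {u \<in> verts H. \<forall>v\<in>verts H. \<exists>s\<in>S. gdist H u s \<ge> gdist H v s}"

subsection \<open>Plane graphs\<close>

text \<open>
  Vertices are points of the plane and edges are point sets, namely images of arcs; a plane graph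
  thus carries its embedding with it.
\<close>

record plane_pregraph =
  vertices :: "(real^2) set"
  edges :: "(real^2) set set"

definition arc_between :: "(real^2) set \<Rightarrow> real^2 \<Rightarrow> real^2 \<Rightarrow> bool" where
  "arc_between e x y \<longleftrightarrow> (\<exists>g. arc g \<and> path_image g = e \<and> pathstart g = x \<and> pathfinish g = y)"

locale plane_graph =
  fixes G :: plane_pregraph
  assumes finite_vertices: "finite (vertices G)"
    and finite_edges: "finite (edges G)"
    and edge_arc: "e \<in> edges G \<Longrightarrow> \<exists>x\<in>vertices G. \<exists>y\<in>vertices G. arc_between e x y"
    and edge_simple: "\<lbrakk>e \<in> edges G; e' \<in> edges G; arc_between e x y; arc_between e' x y\<rbrakk> \<Longrightarrow> e = e'"
    and interior_vertex: "\<lbrakk>e \<in> edges G; arc_between e x y\<rbrakk> \<Longrightarrow> (e - {x, y}) \<inter> vertices G = {}"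
    and interior_edge:
      "\<lbrakk>e \<in> edges G; e' \<in> edges G; e \<noteq> e'; arc_between e x y\<rbrakk> \<Longrightarrow> (e - {x, y}) \<inter> e' = {}"

definition abs_graph :: "plane_pregraph \<Rightarrow> (real^2, (real^2) \<times> (real^2)) pre_digraph" where
  "abs_graph G = with_proj
    \<lparr>pverts = vertices G, parcs = {(x, y). \<exists>e\<in>edges G. arc_between e x y}\<rparr>"

definition plane_subgraph :: "plane_pregraph \<Rightarrow> plane_pregraph \<Rightarrow> bool" where
  "plane_subgraph H G \<longleftrightarrow>
    plane_graph H \<and> plane_graph G \<and> vertices H \<subseteq> vertices G \<and> edges H \<subseteq> edges G"

definition point_set :: "plane_pregraph \<Rightarrow> (real^2) set" where
  "point_set G = vertices G \<union> \<Union> (edges G)"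

definition faces :: "plane_pregraph \<Rightarrow> (real^2) set set" where
  "faces G = components (- point_set G)"

definition face_boundary :: "plane_pregraph \<Rightarrow> (real^2) set \<Rightarrow> plane_pregraph" where
  "face_boundary G f =
    \<lparr>vertices = {v \<in> vertices G. v \<in> frontier f}, edges = {e \<in> edges G. e \<subseteq> frontier f}\<rparr>"

lemma arc_between_commute: "arc_between e x y \<longleftrightarrow> arc_between e y x"
proof -
  have "arc_between e y x" if "arc_between e x y" for x y
    using that unfolding arc_between_def
    by (metis arc_reversepath path_image_reversepath pathfinish_reversepath pathstart_reversepath)
  then show ?thesis by blast
qed

lemma arc_between_imp:
  assumes "arc_between e x y"
  shows "x \<in> e" "y \<in> e" "x \<noteq> y"
  using assms unfolding arc_between_def
  by (auto dest: arc_distinct_ends)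

context plane_graph
begin

lemma edge_ends_vertices:
  assumes "e \<in> edges G" "arc_between e x y"
  shows "x \<in> vertices G" "y \<in> vertices G"
proof -
  obtain a b where ab: "a \<in> vertices G" "b \<in> vertices G" "arc_between e a b"
    using edge_arc assms(1) by blast
  have "a \<in> {x, y}" "b \<in> {x, y}" "a \<noteq> b"
    using interior_vertex[OF assms] ab arc_between_imp[OF ab(3)] by blast+
  then show "x \<in> vertices G" "y \<in> vertices G" using ab by auto
qed

lemma pair_graph_abs_graph:
  "pair_graph \<lparr>pverts = vertices G, parcs = {(x, y). \<exists>e\<in>edges G. arc_between e x y}\<rparr>"
    (is "pair_graph ?G")
proof -
  have "parcs ?G \<subseteq> vertices G \<times> vertices G"
    using edge_ends_vertices by auto
  then have "finite (parcs ?G)"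
    using finite_vertices finite_subset by blast
  then show ?thesis
    using finite_vertices
    by unfold_locales
      (auto simp: symmetric_def sym_def arc_between_commute
        dest: edge_ends_vertices arc_between_imp)
qed

lemma plane_graph_sub:
  assumes "V \<subseteq> vertices G" "E \<subseteq> edges G"
    and "\<And>e x y. \<lbrakk>e \<in> E; arc_between e x y\<rbrakk> \<Longrightarrow> x \<in> V \<and> y \<in> V"
  shows "plane_graph \<lparr>vertices = V, edges = E\<rparr>"
proof
  fix e assume "e \<in> edges \<lparr>vertices = V, edges = E\<rparr>"
  then show "\<exists>x\<in>vertices \<lparr>vertices = V, edges = E\<rparr>. \<exists>y\<in>vertices \<lparr>vertices = V, edges = E\<rparr>. arc_between e x y"
    using assms(2,3) edge_arc by simp blast
next
  fix e e' x y
  assume "e \<in> edges \<lparr>vertices = V, edges = E\<rparr>" "e' \<in> edges \<lparr>vertices = V, edges = E\<rparr>"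
    "arc_between e x y" "arc_between e' x y"
  then show "e = e'"
    using assms(2) edge_simple by simp blast
next
  fix e x y
  assume "e \<in> edges \<lparr>vertices = V, edges = E\<rparr>" "arc_between e x y"
  then show "(e - {x, y}) \<inter> vertices \<lparr>vertices = V, edges = E\<rparr> = {}"
    using assms(1,2) interior_vertex by simp blast
next
  fix e e' x y
  assume "e \<in> edges \<lparr>vertices = V, edges = E\<rparr>" "e' \<in> edges \<lparr>vertices = V, edges = E\<rparr>"
    "e \<noteq> e'" "arc_between e x y"
  then show "(e - {x, y}) \<inter> e' = {}"
    using assms(2) interior_edge[of e e' x y] by auto
qed (use assms finite_vertices finite_edges in \<open>auto intro: finite_subset\<close>)

lemma plane_subgraph_face_boundary: "plane_subgraph (face_boundary G f) G"
  unfolding plane_subgraph_def face_boundary_def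
  using plane_graph_axioms by (auto intro!: plane_graph_sub dest: edge_ends_vertices arc_between_imp)

end

lemma subgraph_abs_graph:
  assumes "plane_subgraph H G"
  shows "subgraph (abs_graph H) (abs_graph G)"
proof -
  have "wf_digraph (abs_graph H)" "wf_digraph (abs_graph G)"
    using assms pair_graph.axioms plane_graph.pair_graph_abs_graph
    unfolding plane_subgraph_def abs_graph_def
    by (auto intro!: wf_digraph.intro dest: plane_graph.edge_ends_vertices)
  then show ?thesis
    using assms by (auto simp: plane_subgraph_def subgraph_def compatible_def abs_graph_def)
qed

end

theory Submission
  imports Defs
begin

text \<open>
  Take a vertex \<open>w\<close> of \<open>G\<close> at distance \<open>\<alpha>\<close> from \<open>u\<close>. As \<open>H\<close> is isometric and \<open>e\<^sub>H(u) < \<alpha>\<close>, \<open>w\<close> lies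
  outside \<open>H\<close>, in a face \<open>f\<close>. For \<open>v\<close> in \<open>H\<close>, a shortest path from \<open>v\<close> to \<open>w\<close> leaves \<open>H\<close> for the last
  time at some \<open>s\<close> on the boundary of \<open>f\<close>, whence
  \<open>d(v,s) + d(s,w) = d(v,w) \<le> \<alpha> = d(u,w) \<le> d(u,s) + d(s,w)\<close>.
\<close>

section \<open>Distances and eccentricities measured by walks\<close>

context wf_digraph
begin

text \<open>Each step of \<open>awalk_to_apath\<close> cuts a cycle out of the walk, so the length
  never grows.\<close>

lemma length_awalk_to_apath_le:
  assumes "awalk u p v"
  shows "length (awalk_to_apath p) \<le> length p"
  using assms
proof (induct rule: awalk_to_apath_induct)
  case (path p)
  then have "awalk_to_apath p = p"
    by (auto simp: awalk_to_apath.simps)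
  then show ?case
    by simp
next
  case (decomp p q r s)
  then have "p = q @ r @ s"
    by (auto elim!: awalk_cyc_decompE)
  then show ?case
    using step_awalk_to_apath[of _ p _ q r s] decomp by simp
qed

text \<open>Since \<open>gdist\<close> ranges over paths only, this lets concatenations and pieces
  of walks bound distances without a check for repeated vertices.\<close>

lemma gdist_le_awalk_length:
  assumes "awalk u p v"
  shows "gdist G u v \<le> enat (length p)"
proof -
  have "apath u (awalk_to_apath p) v"
    using assms by (rule apath_awalk_to_apath)
  then have "gdist G u v \<le> enat (length (awalk_to_apath p))"
    unfolding gdist_def by (intro INF_lower) simp
  also have "\<dots> \<le> enat (length p)"
    using length_awalk_to_apath_le[OF assms] by simp
  finally show ?thesis .
qed

text \<open>\<open>enat\<close> is well-ordered, so the infimum over a nonempty set of paths is a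
  minimum; over the empty set it is \<infinity>, the excluded value.\<close>

lemma gdist_attained:
  assumes "gdist G u v \<noteq> \<infinity>"
  obtains p where "awalk u p v" "gdist G u v = enat (length p)"
proof -
  have "{p. apath u p v} \<noteq> {}"
    using assms unfolding gdist_def by (metis INF_empty top_enat_def)
  then obtain q where "apath u q v"
    by blast
  then have "gdist G u v \<in> (\<lambda>p. enat (length p)) ` {p. apath u p v}"
    unfolding gdist_def by (intro wellorder_InfI[of "enat (length q)"] imageI) simp
  then show thesis
    using that awalkI_apath by blast
qed

lemma gdist_triangle:
  "gdist G u w \<le> gdist G u v + gdist G v w"
proof (cases "gdist G u v = \<infinity> \<or> gdist G v w = \<infinity>")
  case False
  then obtain p q where p: "awalk u p v" "gdist G u v = enat (length p)"
    and q: "awalk v q w" "gdist G v w = enat (length q)"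
    using gdist_attained by metis
  have "awalk u (p @ q) w"
    using p(1) q(1) by (rule awalk_appendI)
  then show ?thesis
    using gdist_le_awalk_length[of u "p @ q" w] p(2) q(2) by simp
qed auto

end

lemma (in fin_digraph) gdist_le_ecc:
  assumes "v \<in> verts G"
  shows "gdist G u v \<le> ecc G u"
  unfolding ecc_def using assms by (intro Max_ge) auto

lemma (in fin_digraph) ecc_attained:
  assumes "verts G \<noteq> {}"
  obtains v where "v \<in> verts G" "ecc G u = gdist G u v"
proof -
  have "ecc G u \<in> {gdist G u x | x. x \<in> verts G}"
    unfolding ecc_def using assms by (intro Max_in) auto
  then show thesis using that by blast
qed

section \<open>Edges and walks of a plane graph relative to the faces of a plane subgraph\<close>

lemma arc_between_remove_end:
  assumes "arc_between e x y"
  shows "topological_space_class.connected (e - {x})" "x \<in> closure (e - {x})"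
proof -
  obtain g where g: "arc g" "path_image g = e" "pathstart g = x"
    using assms unfolding arc_between_def by blast
  have inj: "inj_on g {0..1}" and cont: "continuous_on {0..1} g"
    using g(1) by (auto simp: arc_def path_def)
  \<comment> \<open>By injectivity of \<open>g\<close>, deleting the end \<open>x\<close> leaves the
    image of a half-open interval, whose closure contains 0.\<close>
  have "{0<..1} = {0..1} - {0::real}"
    by auto
  then have eq: "e - {x} = g ` {0<..1}"
    using g(2,3) inj_on_image_set_diff[OF inj, of "{0..1}" "{0}"]
    by (simp add: path_image_def pathstart_def)
  show "topological_space_class.connected (e - {x})"
    unfolding eq by (intro connected_continuous_image continuous_on_subset[OF cont]) auto
  have "g ` closure {0<..1} \<subseteq> closure (g ` {0<..1})"
    using cont by (intro image_closure_subset closure_subset) auto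
  then show "x \<in> closure (e - {x})"
    unfolding eq using g(3) by (auto simp: pathstart_def)
qed

lemma abs_graph_simps [simp]:
  "verts (abs_graph G) = vertices G"
  "arcs (abs_graph G) = {(x, y). \<exists>e\<in>edges G. arc_between e x y}"
  "tail (abs_graph G) = fst"
  "head (abs_graph G) = snd"
  by (simp_all add: abs_graph_def)

context plane_graph
begin

lemma fin_digraph_abs_graph: "fin_digraph (abs_graph G)"
proof -
  interpret pair_graph "\<lparr>pverts = vertices G, parcs = {(x, y). \<exists>e\<in>edges G. arc_between e x y}\<rparr>"
    by (rule pair_graph_abs_graph)
  show ?thesis
    unfolding abs_graph_def by unfold_locales
qed

text \<open>Otherwise \<open>w\<close> would be interior to an edge of \<open>H\<close>, which is
  also an edge of \<open>G\<close>, and edges of \<open>G\<close> have no vertices of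
  \<open>G\<close> in their interior.\<close>

lemma vertex_not_in_point_set:
  assumes "plane_subgraph H G" "w \<in> vertices G" "w \<notin> vertices H"
  shows "w \<notin> point_set H"
proof
  interpret H: plane_graph H
    using assms(1) by (simp add: plane_subgraph_def)
  assume "w \<in> point_set H"
  then obtain e where e: "e \<in> edges H" "w \<in> e"
    using assms(3) by (auto simp: point_set_def)
  then obtain x y where "x \<in> vertices H" "y \<in> vertices H" "arc_between e x y"
    using H.edge_arc by blast
  then show False
    using e assms interior_vertex[of e x y] by (auto simp: plane_subgraph_def)
qed

text \<open>The edge without \<open>x\<close> is connected and avoids \<open>H\<close>, hence lies
  in the single component \<open>f\<close>; its other end \<open>x\<close> is then in the closure of
  \<open>f\<close>.\<close>

lemma edge_into_face:
  assumes sub: "plane_subgraph H G" and "e \<in> edges G" "arc_between e x y"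
    and f: "f \<in> faces H" "y \<in> f"
  shows "x \<in> f \<or> x \<in> vertices H \<inter> frontier f"
proof -
  let ?P = "point_set H"
  have maximal: "A \<subseteq> f" if "topological_space_class.connected A" "A \<subseteq> - ?P" "y \<in> A" for A
    using components_maximal[of f "- ?P" A] f that unfolding faces_def by blast
  have disj: "f \<inter> ?P = {}"
    using f in_components_subset unfolding faces_def by blast
  have y: "y \<notin> ?P"
    using disj f by auto
  \<comment> \<open>An edge of \<open>H\<close> would put its end \<open>y\<close> on the point set
    of \<open>H\<close>. So \<open>e\<close> differs from all edges of \<open>H\<close> and its
    interior misses them.\<close>
  have e_H: "e \<notin> edges H"
    using y arc_between_imp(2)[OF assms(3)] by (auto simp: point_set_def)
  have "(e - {x, y}) \<inter> e' = {}" if "e' \<in> edges H" for e'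
    using that sub e_H by (intro interior_edge[OF assms(2) _ _ assms(3)]) (auto simp: plane_subgraph_def)
  moreover have "(e - {x, y}) \<inter> vertices H = {}"
    using interior_vertex[OF assms(2,3)] sub by (auto simp: plane_subgraph_def)
  ultimately have "(e - {x, y}) \<inter> ?P = {}"
    by (auto simp: point_set_def)
  then have "e - {x} \<subseteq> - ?P"
    using y by auto
  moreover have "y \<in> e - {x}"
    using arc_between_imp[OF assms(3)] by auto
  ultimately have "e - {x} \<subseteq> f"
    using arc_between_remove_end(1)[OF assms(3)] by (intro maximal)
  then have clo: "x \<in> closure f"
    using arc_between_remove_end(2)[OF assms(3)] closure_mono by blast
  show ?thesis
  proof (cases "x \<in> vertices H")
    case True
    then have "x \<notin> f"
      using disj by (auto simp: point_set_def)
    then show ?thesis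
      using True clo interior_subset by (auto simp: frontier_def)
  next
    case False
    have "x \<in> vertices G"
      using edge_ends_vertices(1) assms(2,3) .
    then have "x \<notin> ?P"
      using vertex_not_in_point_set sub False by blast
    \<comment> \<open>With \<open>x\<close> off \<open>H\<close> as well, the maximality argument
      applies to the whole edge.\<close>
    then have "e \<subseteq> - ?P"
      using \<open>e - {x} \<subseteq> - ?P\<close> by blast
    moreover have "topological_space_class.connected e"
      using assms(3) connected_arc_image unfolding arc_between_def by blast
    ultimately have "e \<subseteq> f"
      using arc_between_imp(2)[OF assms(3)] by (intro maximal)
    then show ?thesis
      using arc_between_imp(1)[OF assms(3)] by auto
  qed
qed

text \<open>Induction on the walk from its front end: an edge can enter \<open>f\<close> from
  outside only through a boundary vertex in \<open>H\<close>, and there the walk is split.\<close>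

lemma awalk_into_face:
  assumes sub: "plane_subgraph H G" and f: "f \<in> faces H" "w \<in> f"
    and "pre_digraph.awalk (abs_graph G) v p w"
  shows "v \<in> f \<or> (\<exists>s p1 p2. s \<in> vertices H \<inter> frontier f \<and> p = p1 @ p2 \<and>
    pre_digraph.awalk (abs_graph G) v p1 s \<and> pre_digraph.awalk (abs_graph G) s p2 w)"
  using assms(4)
proof (induction p arbitrary: v)
  interpret A: fin_digraph "abs_graph G"
    by (rule fin_digraph_abs_graph)
  {
    case Nil
    then show ?case
      using f by (simp add: A.awalk_Nil_iff)
  next
    case (Cons a p)
    obtain x y where a: "a = (x, y)"
      by (cases a)
    have arc: "a \<in> arcs (abs_graph G)" and x: "x = v" and p: "A.awalk y p w"
      using Cons.prems a by (auto simp: A.awalk_Cons_iff)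
    obtain e where e: "e \<in> edges G" "arc_between e v y"
      using arc a x by auto
    from Cons.IH[OF p] show ?case
    proof (elim disjE exE conjE)
      assume "y \<in> f"
      then have "v \<in> f \<or> v \<in> vertices H \<inter> frontier f"
        using edge_into_face sub e f(1) by blast
      \<comment> \<open>If \<open>v\<close> itself is the boundary vertex, the split is at
        \<open>s = v\<close> with \<open>p1\<close> empty.\<close>
      moreover have "A.awalk v [] v"
        using Cons.prems by (auto simp: A.awalk_Nil_iff)
      ultimately show ?thesis
        using Cons.prems by (metis append_Nil)
    next
      fix s p1 p2
      assume s: "s \<in> vertices H \<inter> frontier f" "p = p1 @ p2" "A.awalk y p1 s" "A.awalk s p2 w"
      have "A.awalk v (a # p1) s"
        using s(3) Cons.prems a by (auto simp: A.awalk_Cons_iff)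
      then show ?thesis
        using s by (metis append_Cons)
    qed
  }
qed

end

theorem theorem3:
  fixes H :: plane_pregraph and d \<alpha> :: nat
  assumes "plane_graph H"
    and "Digraph_Component.connected (abs_graph H)"
    and "gdiam (abs_graph H) = enat d"
    and "\<alpha> \<ge> d"
    and "\<exists>G. plane_graph G \<and> plane_subgraph H G \<and>
          isometric_subgraph (abs_graph H) (abs_graph G) \<and>
          vertices H \<subseteq> ecc_layer (abs_graph G) \<alpha>"
  shows "\<forall>u\<in>vertices H. ecc (abs_graph H) u < enat \<alpha> \<longrightarrow>
          (\<exists>f\<in>faces H. u \<in> qcc (abs_graph H) (vertices (face_boundary H f)))"
proof (intro ballI impI)
  fix u assume u: "u \<in> vertices H" and ecc_u: "ecc (abs_graph H) u < enat \<alpha>"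
  obtain G where G: "plane_graph G" and sub: "plane_subgraph H G"
    and iso: "isometric_subgraph (abs_graph H) (abs_graph G)"
    and layer: "vertices H \<subseteq> ecc_layer (abs_graph G) \<alpha>"
    using assms(5) by blast
  interpret H: plane_graph H by (rule assms(1))
  interpret G: plane_graph G by (rule G)
  interpret AH: fin_digraph "abs_graph H" by (rule H.fin_digraph_abs_graph)
  interpret AG: fin_digraph "abs_graph G" by (rule G.fin_digraph_abs_graph)
  have dist_eq: "gdist (abs_graph H) x y = gdist (abs_graph G) x y"
    if "x \<in> vertices H" "y \<in> vertices H" for x y
    using iso that by (simp add: isometric_subgraph_def)
  have ecc_G: "ecc (abs_graph G) v = enat \<alpha>" if "v \<in> vertices H" for v
    using layer that by (auto simp: ecc_layer_def)
  have "vertices G \<noteq> {}"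
    using u sub by (auto simp: plane_subgraph_def)
  then obtain w where w: "w \<in> vertices G" "gdist (abs_graph G) u w = enat \<alpha>"
    using AG.ecc_attained[of u] ecc_G[OF u] by (metis abs_graph_simps(1))
  have "w \<notin> vertices H"
    using AH.gdist_le_ecc[of w u] dist_eq[OF u, of w] w(2) ecc_u by auto
  then have "w \<notin> point_set H"
    using G.vertex_not_in_point_set sub w(1) by blast
  then obtain f where f: "f \<in> faces H" "w \<in> f"
    unfolding faces_def by (metis ComplI UnionE Union_components)
  have "\<exists>s\<in>vertices (face_boundary H f). gdist (abs_graph H) u s \<ge> gdist (abs_graph H) v s"
    if v: "v \<in> vertices H" for v
  proof -
    have le: "gdist (abs_graph G) v w \<le> enat \<alpha>"
      using AG.gdist_le_ecc[of w v] w(1) ecc_G[OF v] by simp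
    then have "gdist (abs_graph G) v w \<noteq> \<infinity>"
      by (auto dest: enat_ile)
    then obtain p where p: "AG.awalk v p w" "gdist (abs_graph G) v w = enat (length p)"
      by (rule AG.gdist_attained)
    \<comment> \<open>A vertex of \<open>H\<close> lies in no face, which leaves only the splitting
      alternative of \<open>awalk_into_face\<close>.\<close>
    have "v \<notin> f"
      using v f(1) in_components_subset unfolding faces_def point_set_def by blast
    then obtain s p1 p2 where s: "s \<in> vertices H" "s \<in> frontier f" "p = p1 @ p2"
      "AG.awalk v p1 s" "AG.awalk s p2 w"
      using G.awalk_into_face[OF sub f p(1)] by auto
    have "enat \<alpha> \<le> gdist (abs_graph G) u s + gdist (abs_graph G) s w"
      using AG.gdist_triangle[of u w s] w(2) by simp
    also have "\<dots> \<le> gdist (abs_graph G) u s + enat (length p2)"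
      using AG.gdist_le_awalk_length[OF s(5)] by (intro add_left_mono)
    finally have "enat \<alpha> \<le> gdist (abs_graph G) u s + enat (length p2)" .
    moreover have "enat (length p1) + enat (length p2) \<le> enat \<alpha>"
      using le p(2) s(3) by simp
    \<comment> \<open>The summand \<open>length p2\<close> is finite and cancels; the case split
      deals with an infinite distance, where the bound is trivial.\<close>
    ultimately have "enat (length p1) \<le> gdist (abs_graph G) u s"
      by (cases "gdist (abs_graph G) u s") auto
    then have "gdist (abs_graph G) v s \<le> gdist (abs_graph G) u s"
      using AG.gdist_le_awalk_length[OF s(4)] by (rule order_trans[rotated])
    \<comment> \<open>All of \<open>u\<close>, \<open>v\<close> and \<open>s\<close> lie in
      \<open>H\<close>, so isometry carries the inequality from \<open>G\<close> back to
      \<open>H\<close>.\<close>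
    then show ?thesis
      using s u v dist_eq by (intro bexI[of _ s]) (auto simp: face_boundary_def)
  qed
  then show "\<exists>f\<in>faces H. u \<in> qcc (abs_graph H) (vertices (face_boundary H f))"
    using f(1) u by (auto simp: qcc_def)
qed

end
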